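(* For positive integers $n,p$, let $\mathcal{S}^p_n=\{S\subset\{1,\ldots,n\}: \min S>|S|^p \text{ and } n\in S\}$ and $\mathcal{A}^p_n=\{S\subset\{1,\ldots,n\}: \min S\geqslant |S|^p \text{ and } n\in S\}$. Then for all $n,p\in\mathbb{N}$, $|\mathcal{S}^p_n| = K_{n,p-1}$. Furthermore, $|\mathcal{S}^p_1|=0$ and $|\mathcal{S}^p_{n+1}|=|\mathcal{A}^p_n|$; hence $|\mathcal{A}^p_n|=|\mathcal{S}^p_{n+1}|=K_{n+1,p-1}$.
   Context: For $n\in\mathbb{N}$ and integer $q\geqslant 0$, $K_{n,q}$ denotes the number of ordered tuples $(x_1,\ldots,x_k)$ of positive integers (with any $k\geqslant 1$) such that $\sum_{i=1}^k x_i=n$ and $\min_i x_i>k^q$, i.e. the number of compositions of $n$ whose smallest part is strictly greater than the number of parts raised to the power $q$. Here $\mathbb{N}=\{1,2,\ldots\}$. *)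

theory Defs
  imports Main
begin

definition compositions :: "nat \<Rightarrow> nat list set" where
  "compositions n = {xs. xs \<noteq> [] \<and> (\<forall>x \<in> set xs. 0 < x) \<and> sum_list xs = n}"

definition K :: "nat \<Rightarrow> nat \<Rightarrow> nat" where
  "K n q = card {xs \<in> compositions n. Min (set xs) > length xs ^ q}"

(* The inclusion in {1..n} is not strict: for n = 1 the set {1} is counted by Afam.
   The condition n \<in> S makes S nonempty, so Min S is its least element. *)
definition Sfam :: "nat \<Rightarrow> nat \<Rightarrow> nat set set" where
  "Sfam p n = {S. S \<subseteq> {1..n} \<and> Min S > card S ^ p \<and> n \<in> S}"

definition Afam :: "nat \<Rightarrow> nat \<Rightarrow> nat set set" where
  "Afam p n = {S. S \<subseteq> {1..n} \<and> Min S \<ge> card S ^ p \<and> n \<in> S}"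

(* All sets whose cardinality is taken are finite, so card is the true count. *)
lemma finite_compositions: "finite (compositions n)"
proof (rule finite_subset)
  show "compositions n \<subseteq> {xs. set xs \<subseteq> {..n} \<and> length xs \<le> n}"
  proof
    fix xs assume "xs \<in> compositions n"
    hence pos: "\<forall>x \<in> set xs. 0 < x" and sm: "sum_list xs = n"
      by (auto simp: compositions_def)
    have "length xs \<le> sum_list xs"
      using pos by (induction xs) auto
    moreover have "x \<le> sum_list xs" if "x \<in> set xs" for x
      using that by (auto intro: member_le_sum_list)
    ultimately show "xs \<in> {xs. set xs \<subseteq> {..n} \<and> length xs \<le> n}"
      using sm by auto
  qed
  show "finite {xs. set xs \<subseteq> {..n} \<and> length xs \<le> n}"
    by (rule finite_lists_length_le) simp
qed

lemma finite_Sfam: "finite (Sfam p n)"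
  by (rule finite_subset[of _ "Pow {1..n}"]) (auto simp: Sfam_def)

lemma finite_Afam: "finite (Afam p n)"
  by (rule finite_subset[of _ "Pow {1..n}"]) (auto simp: Afam_def)

end

theory Submission
  imports Defs "HOL-Library.FuncSet"
begin

text \<open>
  Classify both sides by the number \<open>k\<close> of elements, respectively parts. Since
  \<open>k * k ^ (p - 1) = k ^ p\<close>, lowering each part of a composition by \<open>k ^ (p - 1)\<close> and lowering
  the elements of a set by \<open>k ^ p\<close> lead to the same number \<open>(n - k ^ p - 1) choose (k - 1)\<close>.
  The shift \<open>S \<mapsto> S + 1\<close> turns the weak inequality for \<open>n\<close> into the strict one for \<open>n + 1\<close>.
\<close>

text \<open>The fibres of \<open>f\<close> partition \<open>A\<close> and those of \<open>g\<close>
  partition \<open>B\<close>. Summing over the union of both images gives one index set; values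
  attained on neither side never occur there.\<close>

lemma card_eq_if_card_fibres_eq:
  assumes "finite A" "finite B"
    and "\<And>k. card {x \<in> A. f x = k} = card {y \<in> B. g y = k}"
  shows "card A = card B"
proof -
  have "card A = (\<Sum>k \<in> f ` A \<union> g ` B. card {x \<in> A. f x = k})"
    using sum.group[of A "f ` A \<union> g ` B" f "\<lambda>_. 1::nat"] assms(1,2) by simp
  also have "\<dots> = (\<Sum>k \<in> f ` A \<union> g ` B. card {y \<in> B. g y = k})"
    by (simp add: assms(3))
  also have "\<dots> = card B"
    using sum.group[of B "f ` A \<union> g ` B" g "\<lambda>_. 1::nat"] assms(1,2) by simp
  finally show ?thesis .
qed

lemma sum_list_map_add_const:
  fixes xs :: "nat list"
  shows "sum_list (map (\<lambda>x. x + d) xs) = sum_list xs + length xs * d"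
  by (induction xs) auto

lemma sum_list_ge_length_mult:
  fixes xs :: "nat list"
  assumes "\<And>x. x \<in> set xs \<Longrightarrow> d \<le> x"
  shows "length xs * d \<le> sum_list xs"
  using assms by (induction xs) (auto simp: add_mono)

text \<open>Subtracting \<open>d\<close> from every entry leaves arbitrary lists of \<open>k\<close>
  naturals with sum \<open>n - k * d\<close>, counted by stars and bars. The guard matters: if
  \<open>k * d > n\<close>, truncated subtraction would turn the binomial into 1.\<close>

lemma card_lists_sum_list_bounded_below:
  fixes n k d :: nat
  assumes "k > 0"
  shows "card {xs. length xs = k \<and> (\<forall>x \<in> set xs. d \<le> x) \<and> sum_list xs = n}
    = (if k * d \<le> n then (n - k * d + k - 1) choose (k - 1) else 0)"
    (is "card ?A = _")
proof (cases "k * d \<le> n")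
  case True
  let ?B = "{ys. length ys = k \<and> sum_list ys = n - k * d}"
  have "bij_betw (map (\<lambda>x. x + d)) ?B ?A"
  proof (rule bij_betwI[where g = "map (\<lambda>x. x - d)"])
    show "map (\<lambda>x. x + d) \<in> ?B \<rightarrow> ?A"
      using True by (auto simp: sum_list_map_add_const)
    have restore: "map (\<lambda>x. x + d) (map (\<lambda>x. x - d) xs) = xs" if "xs \<in> ?A" for xs
      using that by (auto simp: map_idI)
    show "map (\<lambda>x. x - d) \<in> ?A \<rightarrow> ?B"
    proof
      fix xs assume xs: "xs \<in> ?A"
      have "sum_list xs = sum_list (map (\<lambda>x. x - d) xs) + length xs * d"
        using sum_list_map_add_const[of d "map (\<lambda>x. x - d) xs"]
        unfolding restore[OF xs] length_map .
      with xs show "map (\<lambda>x. x - d) xs \<in> ?B" by auto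
    qed
    show "map (\<lambda>x. x + d) (map (\<lambda>x. x - d) xs) = xs" if "xs \<in> ?A" for xs
      using restore[OF that] .
  qed (simp add: map_idI)
  then have "card ?A = card ?B"
    by (simp add: bij_betw_same_card)
  also have "\<dots> = (n - k * d + k - 1) choose (n - k * d)"
    by (rule card_length_sum_list)
  also have "\<dots> = (n - k * d + k - 1) choose (k - 1)"
    using assms by (subst binomial_symmetric) auto
  finally show ?thesis using True by simp
next
  case False
  then have "?A = {}"
    using sum_list_ge_length_mult by blast
  then show ?thesis using False by (simp only: card.empty if_False)
qed

text \<open>The maximum \<open>n\<close> is forced, and the other \<open>k - 1\<close> elements are
  free among the \<open>n - m - 1\<close> numbers strictly between \<open>m\<close> and
  \<open>n\<close>.\<close>

lemma card_subsets_with_max: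
  fixes n m k :: nat
  assumes "k > 0"
  shows "card {S. S \<subseteq> {m<..n} \<and> n \<in> S \<and> card S = k}
    = (if m < n then (n - m - 1) choose (k - 1) else 0)"
    (is "card ?A = _")
proof (cases "m < n")
  case True
  let ?B = "{T. T \<subseteq> {m<..<n} \<and> card T = k - 1}"
  have "bij_betw (insert n) ?B ?A"
  proof (rule bij_betwI[where g = "\<lambda>S. S - {n}"])
    show "insert n \<in> ?B \<rightarrow> ?A"
    proof
      fix T assume T: "T \<in> ?B"
      then have "finite T" "n \<notin> T" by (auto intro: finite_subset)
      with T True assms show "insert n T \<in> ?A" by auto
    qed
    show "(\<lambda>S. S - {n}) \<in> ?A \<rightarrow> ?B"
      by (auto simp: subset_iff less_le)
  qed auto
  then have "card ?A = card ?B"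
    by (simp add: bij_betw_same_card)
  also have "\<dots> = (n - m - 1) choose (k - 1)"
    by (simp add: n_subsets)
  finally show ?thesis using True by simp
next
  case False
  then have "?A = {}" by auto
  then show ?thesis using False by simp
qed

lemma Sfam_iff:
  "S \<in> Sfam p n \<longleftrightarrow> S \<subseteq> {1..n} \<and> n \<in> S \<and> (\<forall>x \<in> S. card S ^ p < x)"
proof -
  have "S \<subseteq> {1..n} \<Longrightarrow> n \<in> S \<Longrightarrow> card S ^ p < Min S \<longleftrightarrow> (\<forall>x \<in> S. card S ^ p < x)"
    by (subst Min_gr_iff) (auto intro: finite_subset)
  then show ?thesis by (auto simp: Sfam_def)
qed

lemma Afam_iff:
  "S \<in> Afam p n \<longleftrightarrow> S \<subseteq> {1..n} \<and> n \<in> S \<and> (\<forall>x \<in> S. card S ^ p \<le> x)"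
proof -
  have "S \<subseteq> {1..n} \<Longrightarrow> n \<in> S \<Longrightarrow> card S ^ p \<le> Min S \<longleftrightarrow> (\<forall>x \<in> S. card S ^ p \<le> x)"
    by (subst Min_ge_iff) (auto intro: finite_subset)
  then show ?thesis by (auto simp: Afam_def)
qed

lemma card_pos_if_mem_Sfam:
  assumes "S \<in> Sfam p n"
  shows "card S > 0"
  using assms by (auto simp: Sfam_def card_gt_0_iff intro: finite_subset)

lemma card_Sfam_fibre:
  assumes "k > 0"
  shows "card {S \<in> Sfam p n. card S = k}
    = (if k ^ p < n then (n - k ^ p - 1) choose (k - 1) else 0)"
proof -
  \<comment> \<open>Once the cardinality is fixed, the bound on the minimum is the constant
    \<open>k ^ p\<close>, so it becomes an interval condition.\<close>
  have "{S \<in> Sfam p n. card S = k} = {S. S \<subseteq> {k ^ p<..n} \<and> n \<in> S \<and> card S = k}"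
    by (force simp: Sfam_iff subset_iff)
  then show ?thesis
    using card_subsets_with_max[OF assms] by simp
qed

text \<open>Each part is at least \<open>d = k ^ q + 1\<close>, and
  \<open>k * d = k ^ Suc q + k\<close>; this last \<open>k\<close> cancels the \<open>+ k\<close> of
  stars and bars.\<close>

lemma card_compositions_fibre:
  assumes "k > 0"
  shows "card {xs \<in> {xs \<in> compositions n. Min (set xs) > length xs ^ q}. length xs = k}
    = (if k ^ Suc q + k \<le> n then (n - k ^ Suc q - 1) choose (k - 1) else 0)"
proof -
  have "{xs \<in> {xs \<in> compositions n. Min (set xs) > length xs ^ q}. length xs = k}
      = {xs. length xs = k \<and> (\<forall>x \<in> set xs. k ^ q + 1 \<le> x) \<and> sum_list xs = n}"
    using assms by (force simp: compositions_def Suc_le_eq)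
  moreover have "n - k * (k ^ q + 1) + k - 1 = n - k ^ Suc q - 1" if "k * (k ^ q + 1) \<le> n"
    using that assms by (simp add: algebra_simps)
  ultimately show ?thesis
    using card_lists_sum_list_bounded_below[OF assms, of "k ^ q + 1" n]
    by (simp add: algebra_simps)
qed

lemma card_Sfam_eq_K: "card (Sfam (Suc q) n) = K n q"
  unfolding K_def
proof (rule card_eq_if_card_fibres_eq[where f = card and g = length])
  show "finite {xs \<in> compositions n. Min (set xs) > length xs ^ q}"
    by (simp add: finite_compositions)
  fix k
  show "card {S \<in> Sfam (Suc q) n. card S = k}
      = card {xs \<in> {xs \<in> compositions n. Min (set xs) > length xs ^ q}. length xs = k}"
  proof (cases "k = 0")
    case True
    then have "{S \<in> Sfam (Suc q) n. card S = k} = {}"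
      using card_pos_if_mem_Sfam by fastforce
    moreover from True
    have "{xs \<in> {xs \<in> compositions n. Min (set xs) > length xs ^ q}. length xs = k} = {}"
      by (auto simp: compositions_def)
    ultimately show ?thesis by (simp only: card.empty)
  next
    case False
    \<comment> \<open>The two closed forms differ only in their guards. Where just the weaker guard
      holds, the upper entry of the binomial is below \<open>k - 1\<close>, so it vanishes.\<close>
    have "(n - k ^ Suc q - 1) choose (k - 1) = 0" if "k ^ Suc q < n" "\<not> k ^ Suc q + k \<le> n"
      using that by (intro binomial_eq_0) linarith
    moreover have "k ^ Suc q < n" if "k ^ Suc q + k \<le> n"
      using that False by linarith
    moreover have "k > 0" using False by simp
    ultimately show ?thesis
      unfolding card_Sfam_fibre[OF \<open>k > 0\<close>] card_compositions_fibre[OF \<open>k > 0\<close>] by metis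
  qed
qed (rule finite_Sfam)

lemma Sfam_1_empty: "Sfam p 1 = {}"
proof -
  have False if S: "S \<in> Sfam p 1" for S
  proof -
    from S have "card S ^ p < 1" unfolding Sfam_iff by blast
    with card_pos_if_mem_Sfam[OF S] show False by simp
  qed
  then show ?thesis by blast
qed

text \<open>Shifting by one keeps the cardinality \<open>c\<close>, and \<open>c ^ p \<le> x\<close>
  is equivalent to \<open>c ^ p < Suc x\<close>.\<close>

lemma bij_betw_Afam_Sfam: "bij_betw ((`) Suc) (Afam p n) (Sfam p (Suc n))"
  unfolding bij_betw_def
proof
  show "inj_on ((`) Suc) (Afam p n)"
    by (simp add: inj_on_def inj_image_eq_iff)
  show "(`) Suc ` Afam p n = Sfam p (Suc n)"
  proof (intro equalityI subsetI)
    fix S assume "S \<in> (`) Suc ` Afam p n"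
    then show "S \<in> Sfam p (Suc n)"
      by (auto simp: Afam_iff Sfam_iff card_image less_Suc_eq_le subset_iff)
  next
    fix S assume S: "S \<in> Sfam p (Suc n)"
    \<comment> \<open>Since \<open>S\<close> is nonempty, its bound is at least 1, which excludes
      the element 1. Hence lowering \<open>S\<close> by one stays inside
      \<open>{1..n}\<close>.\<close>
    have ge2: "1 < x" if "x \<in> S" for x
    proof -
      have "1 \<le> card S ^ p" using card_pos_if_mem_Sfam[OF S] by simp
      with S that show ?thesis by (auto simp: Sfam_iff)
    qed
    define T where "T = Suc -` S"
    have "S \<subseteq> range Suc"
      using ge2 by (metis less_imp_Suc_add rangeI subsetI)
    then have S_eq: "S = Suc ` T"
      by (auto simp: T_def)
    have "card S = card T"
      by (simp add: S_eq card_image)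
    then have "Suc x \<le> Suc n \<and> card T ^ p < Suc x \<and> 1 < Suc x" if "x \<in> T" for x
      using S ge2 that by (auto simp: T_def Sfam_iff)
    moreover have "n \<in> T"
      using S by (simp add: T_def Sfam_iff)
    ultimately have "T \<in> Afam p n"
      by (auto simp: Afam_iff less_Suc_eq_le)
    then show "S \<in> (`) Suc ` Afam p n"
      using S_eq by blast
  qed
qed

theorem theorem4:
  fixes n p :: nat
  assumes "n \<ge> 1" and "p \<ge> 1"
  shows "card (Sfam p n) = K n (p - 1)
    \<and> card (Sfam p 1) = 0
    \<and> card (Sfam p (n + 1)) = card (Afam p n)
    \<and> card (Afam p n) = card (Sfam p (n + 1))
    \<and> card (Sfam p (n + 1)) = K (n + 1) (p - 1)"
proof -
  have "card (Sfam p m) = K m (p - 1)" for m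
    using card_Sfam_eq_K[of "p - 1" m] assms(2) by simp
  moreover have "card (Afam p n) = card (Sfam p (n + 1))"
    using bij_betw_same_card[OF bij_betw_Afam_Sfam] by simp
  \<comment> \<open>Deleting \<open>One_nat_def\<close> keeps the literal \<open>1\<close>, so that
    \<open>Sfam_1_empty\<close> matches.\<close>
  ultimately show ?thesis by (simp add: Sfam_1_empty del: One_nat_def)
qed

end
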